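(* For every positive integer $k$, with $n = 3^k$ and $A_k = \{x \in \{0,1\}^n : \mathrm{RecMaj}_k(x) = 1\}$, there exists a bijection $\phi \colon \{0,1\}^{n-1} \to A_k$ such that $\mathrm{avgstretch}(\phi) \le 20$.
   Context: The recursive majority of 3's, $\mathrm{RecMaj}_k \colon \{0,1\}^{3^k} \to \{0,1\}$, is defined by: $\mathrm{RecMaj}_1$ is the majority of its 3 input bits; for $k>1$, writing $x = x^{(1)} \circ x^{(2)} \circ x^{(3)}$ with each $x^{(r)} \in \{0,1\}^{3^{k-1}}$ (consecutive thirds), $\mathrm{RecMaj}_k(x) = \mathrm{Maj}(\mathrm{RecMaj}_{k-1}(x^{(1)}),\mathrm{RecMaj}_{k-1}(x^{(2)}),\mathrm{RecMaj}_{k-1}(x^{(3)}))$. One has $|A_k| = 2^{n-1}$. $\mathrm{dist}$ is the Hamming distance, and for a bijection $\phi \colon \{0,1\}^{n-1} \to A_k$, $\mathrm{avgstretch}(\phi) = \mathbb{E}[\mathrm{dist}(\phi(x),\phi(x'))]$ over a uniformly random pair $x,x' \in \{0,1\}^{n-1}$ differing in exactly one coordinate. *)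

theory Defs
  imports "HOL-Probability.Probability"
begin

definition cube :: "nat \<Rightarrow> bool list set" where
  "cube n = {x. length x = n}"

definition hamming_dist :: "bool list \<Rightarrow> bool list \<Rightarrow> nat" where
  "hamming_dist x y = card {i. i < length x \<and> x ! i \<noteq> y ! i}"

definition maj :: "bool \<Rightarrow> bool \<Rightarrow> bool \<Rightarrow> bool" where
  "maj a b c \<longleftrightarrow> (a \<and> b) \<or> (a \<and> c) \<or> (b \<and> c)"

text \<open>
  The level starts at 1; \<open>rec_maj 0\<close> is left unspecified. At level \<open>k\<close> the function is meant to
  be applied to lists of length \<open>3 ^ k\<close>.
\<close>

fun rec_maj :: "nat \<Rightarrow> bool list \<Rightarrow> bool" where
  "rec_maj (Suc 0) x = maj (x ! 0) (x ! 1) (x ! 2)"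
| "rec_maj (Suc (Suc k)) x =
     (let m = 3 ^ Suc k in
      maj (rec_maj (Suc k) (take m x))
          (rec_maj (Suc k) (take m (drop m x)))
          (rec_maj (Suc k) (take m (drop (2 * m) x))))"

definition rec_maj_set :: "nat \<Rightarrow> bool list set" where
  "rec_maj_set k = {x \<in> cube (3 ^ k). rec_maj k x}"

definition cube_edges :: "nat \<Rightarrow> (bool list \<times> bool list) set" where
  "cube_edges n = {(x, y). x \<in> cube n \<and> y \<in> cube n \<and> hamming_dist x y = 1}"

text \<open>
  \<open>cube_edges n\<close> consists of ordered pairs. It is finite, and nonempty for \<open>n \<ge> 1\<close>, so that
  \<open>pmf_of_set\<close> is then the uniform distribution on it.
\<close>

definition avgstretch :: "nat \<Rightarrow> (bool list \<Rightarrow> bool list) \<Rightarrow> real" where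
  "avgstretch n \<phi> =
     measure_pmf.expectation (pmf_of_set (cube_edges n))
       (\<lambda>(x, y). real (hamming_dist (\<phi> x) (\<phi> y)))"

end

theory Submission
  imports Defs
begin

text \<open>
  For every \<open>k\<close> we build bijections \<open>\<phi>\<^sub>k\<^sup>1\<close> and \<open>\<phi>\<^sub>k\<^sup>0\<close> from the cube of dimension \<open>3\<^sup>k - 1\<close> onto the
  1-inputs and the 0-inputs of the recursive majority. Two of the input bits select one of the four
  triples of block values with the prescribed majority; the other bits are split into three parts,
  and the part belonging to a block of value \<open>p\<close> is mapped by \<open>\<phi>\<^sub>k\<^sub>-\<^sub>1\<^sup>p\<close>.
  The selection is arranged so that the triples used by \<open>\<phi>\<^sub>k\<^sup>1\<close> and \<open>\<phi>\<^sub>k\<^sup>0\<close> for the same selector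
  have average distance \<open>3/2\<close>; hence \<open>\<phi>\<^sub>k\<^sup>1 x\<close> and \<open>\<phi>\<^sub>k\<^sup>0 x\<close> have average distance \<open>(3/2)\<^sup>k\<close>.
  Flipping a selector bit changes \<open>3/2\<close> blocks on average, each at cost \<open>(3/2)\<^sup>k\<^sup>-\<^sup>1\<close>, so the stretch
  summed over all directions satisfies \<open>S\<^sub>k = 3 S\<^sub>k\<^sub>-\<^sub>1 + 3 (3/2)\<^sup>k\<^sup>-\<^sup>1\<close>, that is
  \<open>S\<^sub>k = 2 (3\<^sup>k - (3/2)\<^sup>k)\<close>, and the average over the \<open>3\<^sup>k - 1\<close> directions is at most \<open>3\<close>.
\<close>

subsection \<open>Hamming distance and sums over the cube\<close>

lemma hamming_dist_Nil [simp]: "hamming_dist [] y = 0"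
  by (simp add: hamming_dist_def)

lemma hamming_dist_Cons [simp]:
  "hamming_dist (a # x) (b # y) = of_bool (a \<noteq> b) + hamming_dist x y"
proof -
  have "{i. i < length (a # x) \<and> (a # x) ! i \<noteq> (b # y) ! i} =
      (if a \<noteq> b then {0} else {}) \<union> Suc ` {i. i < length x \<and> x ! i \<noteq> y ! i}"
    (is "?L = ?R")
  proof (rule set_eqI)
    show "i \<in> ?L \<longleftrightarrow> i \<in> ?R" for i by (cases i) auto
  qed
  then show ?thesis
    by (simp add: hamming_dist_def card_Un_disjoint card_image)
qed

lemma hamming_dist_append:
  "length x = length y \<Longrightarrow>
   hamming_dist (x @ u) (y @ v) = hamming_dist x y + hamming_dist u v"
  by (induction x y rule: list_induct2) auto

lemma hamming_dist_self [simp]: "hamming_dist x x = 0"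
  by (simp add: hamming_dist_def)

lemma hamming_dist_commute: "length x = length y \<Longrightarrow> hamming_dist x y = hamming_dist y x"
  by (induction x y rule: list_induct2) auto

lemma hamming_dist_eq_0_iff: "length x = length y \<Longrightarrow> hamming_dist x y = 0 \<longleftrightarrow> x = y"
  by (induction x y rule: list_induct2) auto

lemma cube_0: "cube 0 = {[]}"
  by (simp add: cube_def)

lemma cube_Suc: "cube (Suc n) = (#) True ` cube n \<union> (#) False ` cube n"
  by (auto simp: cube_def length_Suc_conv image_iff)

lemma finite_cube [simp]: "finite (cube n)"
  by (induction n) (auto simp: cube_0 cube_Suc)

lemma sum_cube_Suc: "sum f (cube (Suc n)) = (\<Sum>x\<in>cube n. f (True # x) + f (False # x))"
proof -
  have "sum f (cube (Suc n)) = sum f ((#) True ` cube n) + sum f ((#) False ` cube n)"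
    unfolding cube_Suc by (rule sum.union_disjoint) auto
  then show ?thesis by (simp add: sum.reindex sum.distrib)
qed

lemma sum_cube_append:
  "sum f (cube (a + b)) = (\<Sum>x\<in>cube a. \<Sum>u\<in>cube b. f (x @ u))"
  by (induction a arbitrary: f) (simp_all add: cube_0 sum_cube_Suc sum.distrib)

lemma card_cube: "card (cube n) = 2 ^ n"
proof (induction n)
  case (Suc n)
  have "card (cube (Suc n)) = (\<Sum>x\<in>cube (Suc n). 1)" by simp
  also have "\<dots> = 2 ^ Suc n" unfolding sum_cube_Suc using Suc by simp
  finally show ?case .
qed (simp add: cube_0)

section \<open>Ordered edges of the cube\<close>

lemma cube_edges_0: "cube_edges 0 = {}"
  by (auto simp: cube_edges_def cube_0)

lemma finite_cube_edges [simp]: "finite (cube_edges n)"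
  by (rule finite_subset[of _ "cube n \<times> cube n"]) (auto simp: cube_edges_def)

lemma cube_edges_Cons_iff:
  "(a # x, b # y) \<in> cube_edges (Suc n) \<longleftrightarrow>
     a = b \<and> (x, y) \<in> cube_edges n \<or> a \<noteq> b \<and> x = y \<and> x \<in> cube n"
proof (cases "length x = length y")
  case True
  then show ?thesis
    using hamming_dist_eq_0_iff[OF True] by (cases "a = b") (auto simp: cube_edges_def cube_def)
qed (auto simp: cube_edges_def cube_def)

text \<open>An edge keeps the first bit and follows an edge of the tails, or flips the first bit and
  keeps the tail; the flip occurs in both orders because edges are ordered pairs.\<close>

lemma sum_cube_edges_Suc:
  "(\<Sum>(x, y)\<in>cube_edges (Suc n). F x y) =
     (\<Sum>(x, y)\<in>cube_edges n. F (True # x) (True # y) + F (False # x) (False # y)) +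
     (\<Sum>x\<in>cube n. F (True # x) (False # x) + F (False # x) (True # x))"
proof -
  let ?keep = "\<lambda>b. (\<lambda>(x, y). (b # x, b # y)) ` cube_edges n"
  let ?flip = "\<lambda>b. (\<lambda>x. (b # x, (\<not> b) # x)) ` cube n"
  let ?F = "\<lambda>(x, y). F x y"
  have eq: "cube_edges (Suc n) = (?keep True \<union> ?keep False) \<union> (?flip True \<union> ?flip False)"
  proof (intro set_eqI iffI)
    fix p assume p: "p \<in> cube_edges (Suc n)"
    then obtain a x b y where xy: "p = (a # x, b # y)"
      by (auto simp: cube_edges_def cube_def length_Suc_conv)
    show "p \<in> (?keep True \<union> ?keep False) \<union> (?flip True \<union> ?flip False)"
      using p unfolding xy cube_edges_Cons_iff by (cases a; cases b) force+
  qed (auto simp: cube_edges_Cons_iff)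
  have union: "sum ?F (cube_edges (Suc n)) =
      sum ?F (?keep True \<union> ?keep False) + sum ?F (?flip True \<union> ?flip False)"
    unfolding eq by (rule sum.union_disjoint) auto
  have keep_union: "sum ?F (?keep True \<union> ?keep False) = sum ?F (?keep True) + sum ?F (?keep False)"
    by (rule sum.union_disjoint) auto
  have flip_union: "sum ?F (?flip True \<union> ?flip False) = sum ?F (?flip True) + sum ?F (?flip False)"
    by (rule sum.union_disjoint) auto
  have keep: "sum ?F (?keep b) = (\<Sum>(x, y)\<in>cube_edges n. F (b # x) (b # y))" for b
    by (subst sum.reindex) (auto simp: inj_on_def case_prod_unfold)
  have flip: "sum ?F (?flip b) = (\<Sum>x\<in>cube n. F (b # x) ((\<not> b) # x))" for b
    by (subst sum.reindex) (auto simp: inj_on_def)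
  show ?thesis
    unfolding union keep_union flip_union keep flip
    by (simp add: sum.distrib case_prod_unfold)
qed

lemma sum_cube_edges_append:
  "(\<Sum>(x, y)\<in>cube_edges (a + b). F x y) =
     (\<Sum>x\<in>cube a. \<Sum>(u, v)\<in>cube_edges b. F (x @ u) (x @ v)) +
     (\<Sum>(x, y)\<in>cube_edges a. \<Sum>u\<in>cube b. F (x @ u) (y @ u))"
proof (induction a arbitrary: F)
  case (Suc a)
  show ?case
    unfolding add_Suc sum_cube_edges_Suc sum_cube_Suc sum_cube_append Suc
    by (simp add: sum.distrib case_prod_unfold add_ac)
qed (simp add: cube_0 cube_edges_0)

lemma card_cube_edges: "card (cube_edges n) = n * 2 ^ n"
proof (induction n)
  case (Suc n)
  have "card (cube_edges (Suc n)) = (\<Sum>(x, y)\<in>cube_edges (Suc n). 1)" by simp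
  also have "\<dots> = Suc n * 2 ^ Suc n"
    unfolding sum_cube_edges_Suc using Suc by (simp add: card_cube)
  finally show ?case .
qed (simp add: cube_edges_0)

section \<open>Total distances and stretches under concatenation\<close>

definition dist_sum :: "nat \<Rightarrow> (bool list \<Rightarrow> bool list) \<Rightarrow> (bool list \<Rightarrow> bool list) \<Rightarrow> real" where
  "dist_sum n f g = (\<Sum>x\<in>cube n. real (hamming_dist (f x) (g x)))"

definition edge_sum :: "nat \<Rightarrow> (bool list \<Rightarrow> bool list) \<Rightarrow> real" where
  "edge_sum n f = (\<Sum>(x, y)\<in>cube_edges n. real (hamming_dist (f x) (f y)))"

lemma avgstretch_eq_edge_sum:
  assumes "n \<ge> 1"
  shows "avgstretch n \<phi> = edge_sum n \<phi> / (real n * 2 ^ n)"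
proof -
  have "card (cube_edges n) \<noteq> 0" using assms by (simp add: card_cube_edges)
  then have "cube_edges n \<noteq> {}" by auto
  then show ?thesis
    by (simp add: avgstretch_def edge_sum_def integral_pmf_of_set card_cube_edges)
qed

lemma dist_sum_self [simp]: "dist_sum n f f = 0"
  by (simp add: dist_sum_def)

lemma dist_sum_commute:
  assumes "\<And>x. length (f x) = length (g x)"
  shows "dist_sum n f g = dist_sum n g f"
  unfolding dist_sum_def using assms by (simp add: hamming_dist_commute)

lemma dist_sum_append:
  assumes "\<And>x u. x \<in> cube a \<Longrightarrow> h (x @ u) = f x @ g u"
    and "\<And>x u. x \<in> cube a \<Longrightarrow> h' (x @ u) = f' x @ g' u"
    and "\<And>x. length (f x) = length (f' x)"
  shows "dist_sum (a + b) h h' = 2 ^ b * dist_sum a f f' + 2 ^ a * dist_sum b g g'"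
  unfolding dist_sum_def sum_cube_append using assms
  by (simp add: hamming_dist_append sum.distrib card_cube sum_distrib_left)

text \<open>An edge of the product moves in one factor only: the other half of the output is
  unchanged along it and its input is free, whence the powers of 2.\<close>

lemma edge_sum_append:
  assumes "\<And>x u. x \<in> cube a \<Longrightarrow> h (x @ u) = f x @ g u"
    and "\<And>x y. length (f x) = length (f y)"
  shows "edge_sum (a + b) h = 2 ^ b * edge_sum a f + 2 ^ a * edge_sum b g"
proof -
  have "(\<Sum>(x, y)\<in>cube_edges a. \<Sum>u\<in>cube b. real (hamming_dist (h (x @ u)) (h (y @ u)))) =
      (\<Sum>(x, y)\<in>cube_edges a. 2 ^ b * real (hamming_dist (f x) (f y)))"
    by (rule sum.cong)
      (auto simp: cube_edges_def assms(1) hamming_dist_append[OF assms(2)] card_cube)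
  then show ?thesis
    unfolding edge_sum_def sum_cube_edges_append using assms(1)
    by (simp add: hamming_dist_append card_cube sum_distrib_left case_prod_unfold)
qed

subsection \<open>The bijections\<close>

definition glue ::
  "(bool \<Rightarrow> bool list \<Rightarrow> bool list) \<Rightarrow> nat \<Rightarrow> bool \<Rightarrow> bool \<Rightarrow> bool \<Rightarrow> bool list \<Rightarrow> bool list" where
  "glue f m p q r z = f p (take m z) @ f q (take m (drop m z)) @ f r (drop (2 * m) z)"

text \<open>A block contributes only if its prescribed value changes; the two other parts of the
  input range freely, which gives \<open>(2 ^ m)\<^sup>2\<close>.\<close>

lemma dist_sum_glue:
  assumes "\<And>p x. length (f p x) = l"
  shows "dist_sum (m + (m + m)) (glue f m p q r) (glue f m p' q' r') =
    (2 ^ m)\<^sup>2 * dist_sum m (f True) (f False) *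
      (of_bool (p \<noteq> p') + of_bool (q \<noteq> q') + of_bool (r \<noteq> r'))"
proof -
  have *: "dist_sum m (f p) (f p') = dist_sum m (f True) (f False) * of_bool (p \<noteq> p')" for p p'
    using dist_sum_commute[of "f True" "f False" m] assms by (cases p; cases p') auto
  have "dist_sum (m + (m + m)) (glue f m p q r) (glue f m p' q' r') =
      2 ^ (m + m) * dist_sum m (f p) (f p') + 2 ^ m * dist_sum (m + m)
        (\<lambda>z. f q (take m z) @ f r (drop m z)) (\<lambda>z. f q' (take m z) @ f r' (drop m z))"
    by (rule dist_sum_append) (auto simp: glue_def cube_def assms)
  also have "dist_sum (m + m)
      (\<lambda>z. f q (take m z) @ f r (drop m z)) (\<lambda>z. f q' (take m z) @ f r' (drop m z)) =
      2 ^ m * dist_sum m (f q) (f q') + 2 ^ m * dist_sum m (f r) (f r')"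
    by (rule dist_sum_append) (auto simp: cube_def assms)
  finally show ?thesis
    by (simp add: *[of p] *[of q] *[of r] power_add power2_eq_square algebra_simps)
qed

lemma edge_sum_glue:
  assumes "\<And>p x. length (f p x) = l"
  shows "edge_sum (m + (m + m)) (glue f m p q r) =
    (2 ^ m)\<^sup>2 * (edge_sum m (f p) + edge_sum m (f q) + edge_sum m (f r))"
proof -
  have "edge_sum (m + (m + m)) (glue f m p q r) =
      2 ^ (m + m) * edge_sum m (f p) +
      2 ^ m * edge_sum (m + m) (\<lambda>z. f q (take m z) @ f r (drop m z))"
    by (rule edge_sum_append) (auto simp: glue_def cube_def assms)
  also have "edge_sum (m + m) (\<lambda>z. f q (take m z) @ f r (drop m z)) =
      2 ^ m * edge_sum m (f q) + 2 ^ m * edge_sum m (f r)"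
    by (rule edge_sum_append) (auto simp: cube_def assms)
  finally show ?thesis
    by (simp add: power_add power2_eq_square algebra_simps)
qed

text \<open>
  Selectors \<open>00, 01, 11, 10\<close> give the triples \<open>111, 110, 101, 011\<close> for majority \<open>True\<close> and
  \<open>000, 100, 001, 010\<close> for majority \<open>False\<close>.
\<close>

definition sel1 :: "bool \<Rightarrow> bool \<Rightarrow> bool \<Rightarrow> bool" where
  "sel1 b s t = (if b then t \<or> \<not> s else t \<and> \<not> s)"

definition sel2 :: "bool \<Rightarrow> bool \<Rightarrow> bool \<Rightarrow> bool" where
  "sel2 b s t = (if b then \<not> (s \<and> t) else s \<and> \<not> t)"

definition sel3 :: "bool \<Rightarrow> bool \<Rightarrow> bool \<Rightarrow> bool" where
  "sel3 b s t = (if b then s \<or> \<not> t else s \<and> t)"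

lemmas sel_defs = sel1_def sel2_def sel3_def

text \<open>Level 0 sends the only point of the 0-dimensional cube to the only one-bit string of
  value \<open>b\<close>.\<close>

fun maj_bij :: "nat \<Rightarrow> bool \<Rightarrow> bool list \<Rightarrow> bool list" where
  "maj_bij 0 b x = [b]"
| "maj_bij (Suc k) b x = (let s = x ! 0; t = x ! 1 in
     glue (maj_bij k) (3 ^ k - 1) (sel1 b s t) (sel2 b s t) (sel3 b s t) (drop 2 x))"

lemma maj_bij_Suc_Cons:
  "maj_bij (Suc k) b (s # t # z) =
     glue (maj_bij k) (3 ^ k - 1) (sel1 b s t) (sel2 b s t) (sel3 b s t) z"
  by (simp add: Let_def)

lemma length_maj_bij: "length (maj_bij k b x) = 3 ^ k"
  by (induction k arbitrary: b x) (simp_all add: Let_def glue_def)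

text \<open>The input consists of two selector bits and three parts of \<open>3 ^ k - 1\<close>
  bits.\<close>

lemma three_power_Suc_minus_1:
  "3 ^ Suc k - 1 = Suc (Suc ((3 ^ k - 1) + ((3 ^ k - 1) + (3 ^ k - (1 :: nat)))))"
proof -
  have "\<exists>c. (3 :: nat) ^ k = Suc c"
    by (rule not0_implies_Suc) simp
  then obtain c where "(3 :: nat) ^ k = Suc c" ..
  then show ?thesis by simp
qed

text \<open>Extends \<open>rec_maj\<close> to level 0, where it is unspecified, so that inductions
  can start from single bits.\<close>

definition maj_val :: "nat \<Rightarrow> bool list \<Rightarrow> bool" where
  "maj_val k x = (if k = 0 then x ! 0 else rec_maj k x)"

lemma maj_val_Suc:
  assumes "length u = 3 ^ k" "length v = 3 ^ k" "length w = 3 ^ k"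
  shows "maj_val (Suc k) (u @ v @ w) = maj (maj_val k u) (maj_val k v) (maj_val k w)"
proof (cases k)
  case 0
  with assms obtain a b c where "u = [a]" "v = [b]" "w = [c]"
    by (auto simp: length_Suc_conv)
  with 0 show ?thesis by (simp add: maj_val_def)
next
  case (Suc j)
  with assms show ?thesis by (simp add: maj_val_def Let_def)
qed

text \<open>The values of the three output blocks determine the two selector bits, and by induction
  each block determines its part of the input.\<close>

lemma bij_betw_maj_bij:
  "bij_betw (maj_bij k b) (cube (3 ^ k - 1)) {y \<in> cube (3 ^ k). maj_val k y = b}"
proof (induction k arbitrary: b)
  case 0
  have "{y \<in> cube 1. y ! 0 = b} = {[b]}"
    by (auto simp: cube_def length_Suc_conv)
  then show ?case
    by (simp add: bij_betw_def cube_0 maj_val_def)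
next
  case (Suc k)
  define m :: nat where "m = 3 ^ k - 1"
  note IH = Suc[folded m_def]
  have decomp: "x \<in> cube (3 ^ Suc k - 1) \<longleftrightarrow>
      (\<exists>s t u v w. x = s # t # u @ v @ w \<and> u \<in> cube m \<and> v \<in> cube m \<and> w \<in> cube m)"
    for x
    unfolding three_power_Suc_minus_1 m_def[symmetric]
  proof
    assume "x \<in> cube (Suc (Suc (m + (m + m))))"
    then have "length x = Suc (Suc (m + (m + m)))"
      unfolding cube_def by simp
    then obtain s t z where x: "x = s # t # z" and z: "length z = m + (m + m)"
      by (auto simp: length_Suc_conv)
    have "z = take m z @ take m (drop m z) @ drop m (drop m z)"
      by (simp del: drop_drop)
    with x z show "\<exists>s t u v w. x = s # t # u @ v @ w \<and> u \<in> cube m \<and> v \<in> cube m \<and> w \<in> cube m"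
      unfolding cube_def
      by (intro exI[of _ s] exI[of _ t] exI[of _ "take m z"] exI[of _ "take m (drop m z)"]
          exI[of _ "drop m (drop m z)"]) auto
  qed (auto simp: cube_def)
  have phi: "maj_bij (Suc k) b (s # t # u @ v @ w) =
      maj_bij k (sel1 b s t) u @ maj_bij k (sel2 b s t) v @ maj_bij k (sel3 b s t) w"
    if "u \<in> cube m" "v \<in> cube m" for s t u v w
    unfolding maj_bij_Suc_Cons m_def[symmetric] using that by (simp add: glue_def cube_def)
  have val: "maj_val k (maj_bij k p u) = p" if "u \<in> cube m" for p u
    using bij_betwE[OF IH] that by blast
  have inj: "u = u'" if "maj_bij k p u = maj_bij k p u'" "u \<in> cube m" "u' \<in> cube m" for p u u'
    using bij_betw_imp_inj_on[OF IH] that by (auto dest: inj_onD)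
  show ?case
  proof (rule bij_betw_imageI)
    show "inj_on (maj_bij (Suc k) b) (cube (3 ^ Suc k - 1))"
    proof (rule inj_onI)
      fix x x'
      assume "x \<in> cube (3 ^ Suc k - 1)" "x' \<in> cube (3 ^ Suc k - 1)"
        and eq: "maj_bij (Suc k) b x = maj_bij (Suc k) b x'"
      then obtain s t u v w s' t' u' v' w' where
        x: "x = s # t # u @ v @ w" and cubes: "u \<in> cube m" "v \<in> cube m" "w \<in> cube m" and
        x': "x' = s' # t' # u' @ v' @ w'" and cubes': "u' \<in> cube m" "v' \<in> cube m" "w' \<in> cube m"
        unfolding decomp by blast
      have eqs: "maj_bij k (sel1 b s t) u = maj_bij k (sel1 b s' t') u'"
        "maj_bij k (sel2 b s t) v = maj_bij k (sel2 b s' t') v'"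
        "maj_bij k (sel3 b s t) w = maj_bij k (sel3 b s' t') w'"
        using eq unfolding x x' phi[OF cubes(1,2)] phi[OF cubes'(1,2)]
        by (simp_all add: length_maj_bij)
      then have sels: "sel1 b s t = sel1 b s' t'" "sel2 b s t = sel2 b s' t'"
        "sel3 b s t = sel3 b s' t'"
        using val cubes cubes' by metis+
      \<comment> \<open>For fixed \<open>b\<close> the four selectors yield four different
        triples.\<close>
      then have "s = s'" "t = t'"
        by (auto simp: sel_defs split: if_splits)
      moreover have "u = u'" "v = v'" "w = w'"
        using eqs[unfolded sels] inj cubes cubes' by blast+
      ultimately show "x = x'" unfolding x x' by simp
    qed
    show "maj_bij (Suc k) b ` cube (3 ^ Suc k - 1) = {y \<in> cube (3 ^ Suc k). maj_val (Suc k) y = b}"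
    proof (intro set_eqI iffI)
      fix y assume "y \<in> maj_bij (Suc k) b ` cube (3 ^ Suc k - 1)"
      then obtain s t u v w where y: "y = maj_bij (Suc k) b (s # t # u @ v @ w)"
        and cubes: "u \<in> cube m" "v \<in> cube m" "w \<in> cube m"
        unfolding image_iff Bex_def decomp by blast
      have "maj_val (Suc k) y = maj (sel1 b s t) (sel2 b s t) (sel3 b s t)"
        unfolding y phi[OF cubes(1,2)] by (simp add: maj_val_Suc length_maj_bij val cubes)
      also have "\<dots> = b" by (auto simp: sel_defs maj_def)
      finally show "y \<in> {y \<in> cube (3 ^ Suc k). maj_val (Suc k) y = b}"
        unfolding y by (simp add: cube_def length_maj_bij del: maj_bij.simps)
    next
      fix y assume "y \<in> {y \<in> cube (3 ^ Suc k). maj_val (Suc k) y = b}"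
      then have len: "length y = 3 * 3 ^ k" and yb: "maj_val (Suc k) y = b"
        by (auto simp: cube_def)
      define c where "c = (3 :: nat) ^ k"
      define y1 y2 y3 where "y1 = take c y" and "y2 = take c (drop c y)"
        and "y3 = drop c (drop c y)"
      have y: "y = y1 @ y2 @ y3" by (simp add: y1_def y2_def y3_def del: drop_drop)
      have lens: "length y1 = 3 ^ k" "length y2 = 3 ^ k" "length y3 = 3 ^ k"
        using len by (simp_all add: y1_def y2_def y3_def c_def)
      have "maj (maj_val k y1) (maj_val k y2) (maj_val k y3) = b"
        using yb unfolding y maj_val_Suc[OF lens] .
      \<comment> \<open>Every triple with majority \<open>b\<close> is one of the four selected
        ones, which gives surjectivity.\<close>
      then have "\<exists>s t. sel1 b s t = maj_val k y1 \<and> sel2 b s t = maj_val k y2 \<and>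
          sel3 b s t = maj_val k y3"
        unfolding ex_bool_eq
        by (cases "maj_val k y1"; cases "maj_val k y2"; cases "maj_val k y3")
          (auto simp: sel_defs maj_def)
      then obtain s t where st: "sel1 b s t = maj_val k y1" "sel2 b s t = maj_val k y2"
          "sel3 b s t = maj_val k y3" by blast
      have pre: "\<exists>u\<in>cube m. maj_bij k (maj_val k z) u = z" if "length z = 3 ^ k" for z
      proof -
        have "z \<in> maj_bij k (maj_val k z) ` cube m"
          unfolding bij_betw_imp_surj_on[OF IH] using that by (simp add: cube_def)
        then show ?thesis by (metis imageE)
      qed
      obtain u v w where uvw: "u \<in> cube m" "v \<in> cube m" "w \<in> cube m"
        "maj_bij k (maj_val k y1) u = y1" "maj_bij k (maj_val k y2) v = y2"
        "maj_bij k (maj_val k y3) w = y3"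
        using pre[OF lens(1)] pre[OF lens(2)] pre[OF lens(3)] by blast
      have "maj_bij (Suc k) b (s # t # u @ v @ w) = y"
        unfolding phi[OF uvw(1,2)] st uvw y by simp
      moreover have "s # t # u @ v @ w \<in> cube (3 ^ Suc k - 1)"
        unfolding decomp using uvw by blast
      ultimately show "y \<in> maj_bij (Suc k) b ` cube (3 ^ Suc k - 1)" by blast
    qed
  qed
qed

subsection \<open>Distances and stretch\<close>

lemma dist_sum_maj_bij:
  "dist_sum (3 ^ k - 1) (maj_bij k True) (maj_bij k False) = (3 / 2) ^ k * 2 ^ (3 ^ k - 1)"
proof (induction k)
  case 0
  show ?case by (simp add: dist_sum_def cube_0)
next
  case (Suc k)
  define m :: nat where "m = 3 ^ k - 1"
  have maj_bij: "maj_bij (Suc k) b (s # t # z) =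
      glue (maj_bij k) m (sel1 b s t) (sel2 b s t) (sel3 b s t) z" for b s t z
    unfolding m_def by (rule maj_bij_Suc_Cons)
  let ?D = "\<lambda>s t. dist_sum (m + (m + m))
    (glue (maj_bij k) m (sel1 True s t) (sel2 True s t) (sel3 True s t))
    (glue (maj_bij k) m (sel1 False s t) (sel2 False s t) (sel3 False s t))"
  have "dist_sum (3 ^ Suc k - 1) (maj_bij (Suc k) True) (maj_bij (Suc k) False) =
      ?D True True + ?D False True + ?D True False + ?D False False"
    unfolding three_power_Suc_minus_1 m_def[symmetric]
    by (simp add: dist_sum_def sum_cube_Suc maj_bij sum.distrib del: maj_bij.simps)
  \<comment> \<open>For selectors 00, 01, 11, 10 the triples for \<open>True\<close> and
    \<open>False\<close> differ in 3, 1, 1, 1 blocks: 6 in all.\<close>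
  also have "\<dots> = 6 * (2 ^ m)\<^sup>2 * dist_sum m (maj_bij k True) (maj_bij k False)"
    unfolding dist_sum_glue[OF length_maj_bij] by (simp add: sel_defs)
  also have "\<dots> = (3 / 2) ^ Suc k * 2 ^ (3 ^ Suc k - 1)"
    unfolding three_power_Suc_minus_1 m_def[symmetric] Suc[folded m_def]
    by (simp add: power_add power2_eq_square)
  finally show ?case .
qed

text \<open>The total is the same for both \<open>b\<close>, so blocks of either value enter the
  recurrence alike.\<close>

lemma edge_sum_maj_bij:
  "edge_sum (3 ^ k - 1) (maj_bij k b) = 2 * (3 ^ k - (3 / 2) ^ k) * 2 ^ (3 ^ k - 1)"
proof (induction k arbitrary: b)
  case 0
  show ?case by (simp add: edge_sum_def cube_edges_0)
next
  case (Suc k)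
  define m :: nat where "m = 3 ^ k - 1"
  have maj_bij: "maj_bij (Suc k) b (s # t # z) =
      glue (maj_bij k) m (sel1 b s t) (sel2 b s t) (sel3 b s t) z" for s t z
    unfolding m_def by (rule maj_bij_Suc_Cons)
  let ?g = "\<lambda>s t. glue (maj_bij k) m (sel1 b s t) (sel2 b s t) (sel3 b s t)"
  let ?E = "\<lambda>s t. edge_sum (m + (m + m)) (?g s t)"
  let ?D = "\<lambda>s t s' t'. dist_sum (m + (m + m)) (?g s t) (?g s' t')"
  \<comment> \<open>\<open>?E\<close> collects the edges that fix the selector; of the
    \<open>?D\<close> terms the first four flip \<open>s\<close> and the last four flip
    \<open>t\<close>.\<close>
  have "edge_sum (3 ^ Suc k - 1) (maj_bij (Suc k) b) =
      ?E True True + ?E False True + ?E True False + ?E False False +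
      (?D True True False True + ?D False True True True +
       ?D True False False False + ?D False False True False +
       ?D True True True False + ?D True False True True +
       ?D False True False False + ?D False False False True)"
    unfolding three_power_Suc_minus_1 m_def[symmetric] edge_sum_def dist_sum_def
      sum_cube_edges_Suc sum_cube_Suc maj_bij
    by (simp add: sum.distrib case_prod_unfold)
  \<comment> \<open>The four triples have 12 blocks. Around the cycle 00, 01, 11, 10 neighbouring
    triples differ in 1, 2, 2, 1 blocks, and both directions of each edge make 12 again.\<close>
  also have "\<dots> = 12 * (2 ^ m)\<^sup>2 * (2 * (3 ^ k - (3 / 2) ^ k) * 2 ^ m) +
      12 * (2 ^ m)\<^sup>2 * ((3 / 2) ^ k * 2 ^ m)"
    unfolding dist_sum_glue[OF length_maj_bij] edge_sum_glue[OF length_maj_bij]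
      Suc[folded m_def] dist_sum_maj_bij[of k, folded m_def]
    by (cases b) (simp_all add: sel_defs)
  \<comment> \<open>Here \<open>24 * 3 ^ k - 12 * (3 / 2) ^ k\<close> equals
    \<open>8 * (3 ^ Suc k - (3 / 2) ^ Suc k)\<close>, where 8 is twice the number of
    selectors.\<close>
  also have "\<dots> = 2 * (3 ^ Suc k - (3 / 2) ^ Suc k) * 2 ^ (3 ^ Suc k - 1)"
    unfolding three_power_Suc_minus_1 m_def[symmetric]
    by (simp add: power_add power2_eq_square algebra_simps)
  finally show ?case .
qed

theorem theorem3:
  fixes k n :: nat
  assumes "k \<ge> 1" and "n = 3 ^ k"
  shows "\<exists>\<phi>. bij_betw \<phi> (cube (n - 1)) (rec_maj_set k) \<and> avgstretch (n - 1) \<phi> \<le> 20"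
proof (intro exI conjI)
  \<comment> \<open>\<open>maj_val\<close> and \<open>rec_maj\<close> agree from level 1 on.\<close>
  have "rec_maj_set k = {y \<in> cube (3 ^ k). maj_val k y = True}"
    using assms(1) by (auto simp: rec_maj_set_def maj_val_def)
  then show "bij_betw (maj_bij k True) (cube (n - 1)) (rec_maj_set k)"
    using bij_betw_maj_bij[of k True] assms(2) by simp
  have "(3 :: nat) ^ 1 \<le> 3 ^ k"
    using assms(1) by (intro power_increasing) auto
  then have n: "n \<ge> 3" using assms(2) by simp
  \<comment> \<open>Division by the \<open>(n - 1) * 2 ^ (n - 1)\<close> ordered edges cancels the
    power of 2 in the total.\<close>
  then have "avgstretch (n - 1) (maj_bij k True) = 2 * (real n - (3 / 2) ^ k) / real (n - 1)"
    using edge_sum_maj_bij[of k True] assms(2) by (simp add: avgstretch_eq_edge_sum)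
  also have "\<dots> \<le> 2 * real n / real (n - 1)"
    by (intro divide_right_mono) auto
  \<comment> \<open>Since \<open>n \<ge> 3\<close>, the quotient is in fact at most 3.\<close>
  also have "\<dots> \<le> 20"
    using n by (simp add: of_nat_diff field_simps)
  finally show "avgstretch (n - 1) (maj_bij k True) \<le> 20" .
qed

end
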